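(* For all partitions $p=(p_1,\ldots,p_k)$ (with $p_1\ge\cdots\ge p_k\ge1$, $k\ge 1$) we have $$N_p=\frac{1}{\sigma(p)}\sum_{I_1\sqcup_<\cdots\sqcup_<I_h=[k]}(-1)^{k+h}\,|I_1|!\cdots|I_h|!\,\binom{p_{I_1}}{p_{i\in I_1}}\cdots\binom{p_{I_h}}{p_{i\in I_h}}\binom{p_1+\cdots+p_k+h}{p_{I_1}+1,\ldots,p_{I_h}+1},$$ where the sum runs over all partitions of the set $[k]=\{1,\dots,k\}$ into nonempty blocks (with any number $h$ of blocks), the blocks being ordered so that $\min(I_1)<\cdots<\min(I_h)$.
   Context: For $n\ge 0$, $Leib(n)$ is the set of maps $\phi:[n]\to[n]$ with $\phi(i)\le i$ for all $i$. $\Theta_n$ sends $\phi\in Leib(n)$ to the integer partition of $n$ whose parts are the nonzero numbers among $|\phi^{-1}(1)|,\dots,|\phi^{-1}(n)|$. For a partition $p$ of $n$, $N_p:=|\Theta_n^{-1}(p)|$. For $n_1+\cdots+n_k=n$, $\binom{n}{n_1,\dots,n_k}=\frac{n!}{n_1!\cdots n_k!}$. For $I=\{i_1,\dots,i_j\}\subset[k]$, $p_I:=p_{i_1}+\cdots+p_{i_j}$ and $\binom{p_I}{p_{i\in I}}:=\binom{p_I}{p_{i_1},\dots,p_{i_j}}$. The symmetry factor $\sigma(p)$ is the product of the factorials of the multiplicities of the distinct values among $p_1,\dots,p_k$. *)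

theory Defs
  imports Complex_Main "HOL-Library.FuncSet" "HOL-Library.Disjoint_Sets"
begin

definition Leib :: "nat \<Rightarrow> (nat \<Rightarrow> nat) set" where
  "Leib n = {\<phi> \<in> {1..n} \<rightarrow>\<^sub>E {1..n}. \<forall>i\<in>{1..n}. \<phi> i \<le> i}"

(* An integer partition is the weakly decreasing list of its parts; p_i is p ! (i - 1). *)

definition is_partition :: "nat list \<Rightarrow> bool" where
  "is_partition p \<longleftrightarrow> sorted_wrt (\<ge>) p \<and> (\<forall>x\<in>set p. 1 \<le> x)"

definition part :: "nat list \<Rightarrow> nat \<Rightarrow> nat" where
  "part p i = p ! (i - 1)"

definition Theta :: "nat \<Rightarrow> (nat \<Rightarrow> nat) \<Rightarrow> nat list" where
  "Theta n \<phi> = rev (sort (filter (\<lambda>x. x \<noteq> 0) (map (\<lambda>j. card {i\<in>{1..n}. \<phi> i = j}) [1..<Suc n])))"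

definition N_p :: "nat list \<Rightarrow> nat" where
  "N_p p = card {\<phi> \<in> Leib (sum_list p). Theta (sum_list p) \<phi> = p}"

(* The multinomial coefficient of n with lower entries f i for i in I; it is used only when
   these entries sum to n. *)
definition multinomial :: "nat \<Rightarrow> 'i set \<Rightarrow> ('i \<Rightarrow> nat) \<Rightarrow> real" where
  "multinomial n I f = fact n / (\<Prod>i\<in>I. fact (f i))"

definition psum :: "nat list \<Rightarrow> nat set \<Rightarrow> nat" where
  "psum p I = (\<Sum>i\<in>I. part p i)"

definition symmetry_factor :: "nat list \<Rightarrow> nat" where
  "symmetry_factor p = (\<Prod>v\<in>set p. fact (count_list p v))"

(* Set partitions of {1..k} as lists of blocks [I_1, ..., I_h] with increasing minima; the strict
   order makes the blocks distinct, so each set partition occurs exactly once. *)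
definition ordered_set_partitions :: "nat \<Rightarrow> nat set list set" where
  "ordered_set_partitions k =
     {Is. partition_on {1..k} (set Is) \<and> sorted_wrt (\<lambda>I J. Min I < Min J) Is}"

end

(* Labelling the nonempty fibres turns symmetry_factor p * N_p p into the number X(p) of pairs
   (phi, l), where l maps the labels 1, ..., k injectively to values and the fibre over l a has p a
   elements. Deleting the largest argument of phi gives
     X(p) = (SUM a with p a >= 2. X(p - e_a)) + (SUM a with p a = 1. (n - k + 1) * X(p without a)).
   Up to the factor (-1)^k / (PROD i. (p i)!), the right-hand side of the theorem is
     S(p) = (SUM P. (n + card P)! * (PROD I:P. - (card I)! / (p_I + 1))),
   the sum over all set partitions P of the labels. It satisfies S(p) = (SUM i. p i * S(p - e_i)),
   because the sum of p_I + 1 over the blocks of P is n + card P. If p a = 0, sorting the set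
   partitions by the block of a gives S(p) = - (n + 1 - (k - 1)) * S(p without a). Hence both sides
   obey the same recursion. *)
theory Submission
  imports Defs "HOL-Library.Multiset"
begin

subsection \<open>A weighted sum over set partitions\<close>

text \<open>The block of \<open>a\<close> is either \<open>{a}\<close> alone or
  \<open>insert a I\<close> with \<open>I\<close> nonempty. Taking \<open>a\<close> out of it leaves
  a set partition of \<open>K\<close>, in the second case with \<open>I\<close> as one of its
  blocks.\<close>

lemma partition_on_insert_new:
  assumes "a \<notin> K"
  shows "{P. partition_on (insert a K) P} =
    insert {a} ` {P. partition_on K P} \<union>
    (\<lambda>(P, I). insert (insert a I) (P - {I})) ` (SIGMA P:{P. partition_on K P}. P)"
    (is "?L = ?A \<union> ?B")
proof (intro equalityI subsetI)
  fix P assume "P \<in> ?L"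
  then have P: "partition_on (insert a K) P" by simp
  then obtain J where J: "J \<in> P" "a \<in> J"
    by (metis UnionE insertI1 partition_onD1)
  have only: "J' = J" if "J' \<in> P" "a \<in> J'" for J'
    using disjointD[OF partition_onD2[OF P] that(1) J(1)] J(2) that(2) by blast
  have un: "\<Union>(P - {J}) = insert a K - J"
    using J(1) disjointD[OF partition_onD2[OF P] J(1)]
    unfolding partition_onD1[OF P] by blast
  show "P \<in> ?A \<union> ?B"
  proof (cases "J = {a}")
    case True
    have "partition_on K (P - {J})"
      using P un True assms by (auto simp: partition_on_def disjoint_def)
    moreover have "P = insert {a} (P - {J})" using J True by auto
    ultimately show ?thesis by blast
  next
    case False
    define I where "I = J - {a}"
    have I: "I \<noteq> {}" "insert a I = J" using False J by (auto simp: I_def)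
    \<comment> \<open>The nonempty set \<open>I\<close> lies inside \<open>J\<close>, so it cannot
      also be a block disjoint from \<open>J\<close>. Hence deleting \<open>I\<close> below gives
      back exactly \<open>P - {J}\<close>.\<close>
    have nI: "I \<notin> P - {J}"
      using disjointD[OF partition_onD2[OF P] _ J(1), of I] I by (auto simp: I_def)
    have JK: "J \<subseteq> insert a K" using P J by (auto simp: partition_on_def)
    have "partition_on K (insert I (P - {J}))"
    proof (rule partition_onI)
      show "\<Union>(insert I (P - {J})) = K"
        using un JK assms J by (auto simp: I_def)
      show "disjnt p q" if "p \<in> insert I (P - {J})" "q \<in> insert I (P - {J})" "p \<noteq> q" for p q
        using P J that unfolding I_def partition_on_def disjoint_def disjnt_def by blast
      show "{} \<notin> insert I (P - {J})"
        using P I by (auto simp: partition_on_def)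
    qed
    moreover have "P = insert (insert a I) (insert I (P - {J}) - {I})"
      using nI I J by auto
    ultimately have "P \<in> ?B"
      by (intro image_eqI[of _ _ "(insert I (P - {J}), I)"]) auto
    then show ?thesis by simp
  qed
next
  fix Q assume "Q \<in> ?A \<union> ?B"
  then show "Q \<in> ?L"
  proof
    assume "Q \<in> ?A"
    then obtain P where P: "partition_on K P" "Q = insert {a} P" by auto
    then show ?thesis using assms by (auto simp: partition_on_def disjoint_def)
  next
    assume "Q \<in> ?B"
    then obtain P I where P: "partition_on K P" "I \<in> P" "Q = insert (insert a I) (P - {I})"
      by auto
    have "partition_on (insert a K) Q"
    proof (rule partition_onI)
      show "\<Union>Q = insert a K" using P by (auto simp: partition_on_def)
      show "disjnt p q" if "p \<in> Q" "q \<in> Q" "p \<noteq> q" for p q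
        using P that assms unfolding partition_on_def disjoint_def disjnt_def by blast
      show "{} \<notin> Q"
        using P by (auto simp: partition_on_def)
    qed
    then show ?thesis by simp
  qed
qed

text \<open>The two maps that describe the position of \<open>a\<close> are injective and have
  disjoint images, so the sum splits and can be reindexed over the set partitions of
  \<open>K\<close>.\<close>

lemma sum_partition_on_insert:
  fixes g :: "'a set set \<Rightarrow> 'b :: comm_monoid_add"
  assumes "finite K" "a \<notin> K"
  shows "(\<Sum>P | partition_on (insert a K) P. g P) =
    (\<Sum>P | partition_on K P. g (insert {a} P) + (\<Sum>I\<in>P. g (insert (insert a I) (P - {I}))))"
proof -
  let ?Q = "{P. partition_on K P}"
  let ?f = "\<lambda>(P, I). insert (insert a I) (P - {I})"
  have finQ: "finite ?Q" using assms finitely_many_partition_on by blast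
  have finP: "finite P" if "P \<in> ?Q" for P
    using assms that finite_elements by blast
  have notin: "a \<notin> I" if "P \<in> ?Q" "I \<in> P" for P I
    using that assms by (auto simp: partition_on_def)
  have ne: "I \<noteq> {}" if "P \<in> ?Q" "I \<in> P" for P I
    using that by (auto simp: partition_on_def)
  have inj1: "inj_on (insert {a}) ?Q"
    using notin by (intro inj_onI) (metis insert_ident singletonI)
  \<comment> \<open>\<open>Q\<close> determines its preimage: the block through \<open>a\<close>,
    with \<open>a\<close> removed, is \<open>I\<close>, and \<open>P\<close> consists of
    \<open>I\<close> and the blocks of \<open>Q\<close> that avoid \<open>a\<close>.\<close>
  have dest: "P = insert ((THE J. J \<in> Q \<and> a \<in> J) - {a}) {J \<in> Q. a \<notin> J} \<and> I = (THE J. J \<in> Q \<and> a \<in> J) - {a}"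
    if "P \<in> ?Q" "I \<in> P" "Q = ?f (P, I)" for P I Q
  proof -
    have "(THE J. J \<in> Q \<and> a \<in> J) = insert a I"
      using that notin[OF that(1)] by (intro the_equality) auto
    then show ?thesis using that notin[OF that(1)] by auto
  qed
  have inj2: "inj_on ?f (Sigma ?Q (\<lambda>P. P))"
  proof (rule inj_onI)
    fix x y
    assume *: "x \<in> Sigma ?Q (\<lambda>P. P)" "y \<in> Sigma ?Q (\<lambda>P. P)" "?f x = ?f y"
    obtain P I P' I' where xy: "x = (P, I)" "y = (P', I')" by fastforce
    define Q where "Q = ?f (P, I)"
    have Q': "Q = ?f (P', I')" using *(3) unfolding Q_def xy .
    have "P \<in> ?Q" "I \<in> P" "P' \<in> ?Q" "I' \<in> P'" using *(1,2) unfolding xy by auto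
    then show "x = y"
      unfolding xy using dest[OF _ _ Q_def] dest[OF _ _ Q'] by metis
  qed
  have disj: "insert {a} ` ?Q \<inter> ?f ` Sigma ?Q (\<lambda>P. P) = {}"
  proof -
    \<comment> \<open>The images differ in whether \<open>{a}\<close> is a block:
      \<open>{a} = insert a I\<close> would force \<open>I\<close> to be empty, and no block of
      \<open>P'\<close> contains \<open>a\<close>.\<close>
    have False if "P \<in> ?Q" "P' \<in> ?Q" "I \<in> P'" "insert {a} P = ?f (P', I)" for P P' I
    proof -
      have "{a} \<in> ?f (P', I)" using that(4) by (metis insertI1)
      then have "{a} = insert a I \<or> {a} \<in> P'" by auto
      then show False using notin[OF that(2)] ne[OF that(2)] that(3)
        by (metis insert_ident insertI1 empty_iff)
    qed
    then show ?thesis by fastforce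
  qed
  have "(\<Sum>P | partition_on (insert a K) P. g P) =
      sum g (insert {a} ` ?Q) + sum g (?f ` Sigma ?Q (\<lambda>P. P))"
    unfolding partition_on_insert_new[OF assms(2)]
    by (rule sum.union_disjoint) (use finQ finP disj in auto)
  also have "sum g (insert {a} ` ?Q) = (\<Sum>P\<in>?Q. g (insert {a} P))"
    by (simp add: sum.reindex[OF inj1])
  also have "sum g (?f ` Sigma ?Q (\<lambda>P. P)) = (\<Sum>P\<in>?Q. \<Sum>I\<in>P. g (?f (P, I)))"
    unfolding sum.reindex[OF inj2] using finQ finP
    by (subst sum.Sigma) (auto intro!: sum.cong)
  finally show ?thesis by (simp add: sum.distrib)
qed

section \<open>A weighted sum over set partitions and its two recursions\<close>

definition block_weight :: "('a \<Rightarrow> nat) \<Rightarrow> 'a set \<Rightarrow> real" where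
  "block_weight p I = - fact (card I) / (real (sum p I) + 1)"

text \<open>The labels form an arbitrary set and \<open>p\<close> is a function on them, so that a
  label can be deleted, or an entry lowered even to 0, without renumbering. The denominator in a
  block weight is what the quotient of (p_I + 1)! by p_I! leaves when the multinomial coefficients
  are multiplied.\<close>

definition partition_sum :: "'a set \<Rightarrow> ('a \<Rightarrow> nat) \<Rightarrow> real" where
  "partition_sum K p =
     (\<Sum>P | partition_on K P. fact (sum p K + card P) * (\<Prod>I\<in>P. block_weight p I))"

lemma sum_blocks:
  assumes "finite K" "partition_on K P"
  shows "(\<Sum>I\<in>P. sum f I) = sum f K"
  using sum.partition[OF assms, of f] by simp

text \<open>Since \<open>p a = 0\<close>, no block sum changes. As a block of its own,
  \<open>a\<close> has weight -1 and raises the factorial by the factor n + card P + 1; joined to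
  \<open>I\<close>, it multiplies the weight by card I + 1. These last factors add up to card K +
  card P, so card P cancels and the total factor is the same for every \<open>P\<close>.\<close>

lemma partition_sum_insert_zero:
  assumes "finite K" "a \<notin> K" "p a = 0"
  shows "partition_sum (insert a K) p =
    - (real (sum p K) + 1 - real (card K)) * partition_sum K p"
proof -
  let ?w = "block_weight p"
  let ?n = "sum p K"
  have "fact (?n + card (insert {a} P)) * prod ?w (insert {a} P) +
      (\<Sum>I\<in>P. fact (?n + card (insert (insert a I) (P - {I}))) *
          prod ?w (insert (insert a I) (P - {I})))
    = - (real ?n + 1 - real (card K)) * (fact (?n + card P) * prod ?w P)"
    if P: "partition_on K P" for P
  proof -
    have finP: "finite P" using P assms finite_elements by blast
    have a: "{a} \<notin> P" "\<And>I J. J \<in> P \<Longrightarrow> insert a I \<noteq> J" "\<And>I. I \<in> P \<Longrightarrow> a \<notin> I"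
      "\<And>I. I \<in> P \<Longrightarrow> finite I"
      using P assms by (auto simp: partition_on_def finite_UnionD intro: finite_subset)
    have w_a: "?w {a} = -1" using assms by (simp add: block_weight_def)
    have w_insert: "?w (insert a I) = (real (card I) + 1) * ?w I" if "I \<in> P" for I
      using a(3,4)[OF that] assms by (simp add: block_weight_def)
    have single: "fact (?n + card (insert {a} P)) * prod ?w (insert {a} P) =
        - (real ?n + real (card P) + 1) * (fact (?n + card P) * prod ?w P)"
      using finP a(1) w_a by (simp add: algebra_simps)
    have joined: "fact (?n + card (insert (insert a I) (P - {I}))) *
          prod ?w (insert (insert a I) (P - {I})) =
        (real (card I) + 1) * (fact (?n + card P) * prod ?w P)" if "I \<in> P" for I
    proof -
      have "insert a I \<notin> P - {I}" using a(2) by blast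
      moreover have "Suc (card (P - {I})) = card P"
        using finP that by (rule card_Suc_Diff1)
      moreover have "prod ?w P = ?w I * prod ?w (P - {I})"
        using finP that by (rule prod.remove)
      ultimately show ?thesis using finP w_insert[OF that] by simp
    qed
    have "(\<Sum>I\<in>P. real (card I) + 1) = real (card K) + real (card P)"
      using sum_blocks[OF assms(1) P, of "\<lambda>_. 1 :: real"] by (simp add: sum.distrib)
    then show ?thesis
      by (simp add: single joined flip: sum_distrib_right) (simp add: algebra_simps)
  qed
  then show ?thesis
    using assms
    by (simp add: partition_sum_def sum_partition_on_insert sum_distrib_left)
qed

text \<open>Fix \<open>P\<close>. Lowering the entry of a label in \<open>I\<close> multiplies the
  weight of \<open>I\<close> alone by (p_I + 1) / p_I and lowers the argument of the factorial by
  one. The labels of \<open>I\<close>, weighted by their entries, thus contribute p_I + 1 times a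
  common term, and summing over the blocks restores the factor n + card P of the factorial.\<close>

lemma partition_sum_decrement:
  assumes K: "finite K" "K \<noteq> {}" and pos: "\<And>i. i \<in> K \<Longrightarrow> 1 \<le> p i"
  shows "partition_sum K p = (\<Sum>i\<in>K. real (p i) * partition_sum K (p(i := p i - 1)))"
proof -
  let ?q = "\<lambda>i. p(i := p i - 1)"
  have sum_q: "sum (?q i) I + 1 = sum p I" if "i \<in> I" "I \<subseteq> K" for i I
  proof -
    have "finite I" using that K finite_subset by blast
    then show ?thesis using that pos by (force simp: sum.remove[of I i])
  qed
  have "(\<Sum>i\<in>K. real (p i) * (fact (sum (?q i) K + card P) * prod (block_weight (?q i)) P))
      = fact (sum p K + card P) * prod (block_weight p) P"
    if P: "partition_on K P" for P
  proof -
    have finP: "finite P" using P K finite_elements by blast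
    \<comment> \<open>\<open>Suc m\<close> is the argument of the factorial for \<open>p\<close>,
      and \<open>m\<close> the one for every \<open>?q i\<close>. It is a successor because a
      nonempty \<open>K\<close> has at least one block.\<close>
    obtain m where m: "sum p K + card P = Suc m"
    proof -
      have "P \<noteq> {}" using P K by (auto simp: partition_on_def)
      then have "card P > 0" using finP by (simp add: card_gt_0_iff)
      then show ?thesis using that by (metis add_gr_0 gr0_implies_Suc)
    qed
    let ?c = "fact m * prod (block_weight p) P"
    have block: "(\<Sum>i\<in>I. real (p i) * (fact (sum (?q i) K + card P) *
        prod (block_weight (?q i)) P)) = (real (sum p I) + 1) * ?c" if I: "I \<in> P" for I
    proof -
      have IK: "I \<subseteq> K" "I \<noteq> {}" "finite I"
        using P I K by (auto simp: partition_on_def intro: finite_subset)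
      \<comment> \<open>After an entry in \<open>I\<close> is lowered, the denominator of the block
        weight is \<open>sum p I\<close> itself; it has to be nonzero for the cancellation
        below.\<close>
      have s: "sum p I \<noteq> 0" using IK pos by (force simp: sum_eq_0_iff)
      have weight_q: "fact (sum (?q i) K + card P) * prod (block_weight (?q i)) P =
          (real (sum p I) + 1) / real (sum p I) * ?c" if i: "i \<in> I" for i
      proof -
        have "sum (?q i) K + card P = m"
          using sum_q[of i K] i IK m by auto
        moreover have "prod (block_weight (?q i)) (P - {I}) = prod (block_weight p) (P - {I})"
        proof (rule prod.cong[OF refl])
          fix J assume "J \<in> P - {I}"
          then have "i \<notin> J" using P I i by (auto simp: partition_on_def disjoint_def)
          then have "sum (?q i) J = sum p J" by (intro sum.cong) auto
          then show "block_weight (?q i) J = block_weight p J" by (simp add: block_weight_def)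
        qed
        moreover have "block_weight (?q i) I = (real (sum p I) + 1) / real (sum p I) * block_weight p I"
        proof -
          have "real (sum (?q i) I) + 1 = real (sum p I)"
            using sum_q[OF i IK(1)] by linarith
          moreover have "- c / x = (x + 1) / x * (- c / (x + 1))" if "x > 0" for x c :: real
            using that by simp
          ultimately show ?thesis using s unfolding block_weight_def by (metis gr0I of_nat_0_less_iff)
        qed
        ultimately show ?thesis
          using prod.remove[OF finP I, of "block_weight (?q i)"]
            prod.remove[OF finP I, of "block_weight p"] by simp
      qed
      have "(\<Sum>i\<in>I. real (p i) * (fact (sum (?q i) K + card P) * prod (block_weight (?q i)) P))
          = (\<Sum>i\<in>I. real (p i)) * ((real (sum p I) + 1) / real (sum p I) * ?c)"
        unfolding sum_distrib_right by (intro sum.cong refl arg_cong2[of _ _ _ _ "(*)"] weight_q)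
      then show ?thesis using s by (simp flip: of_nat_sum)
    qed
    have "(\<Sum>i\<in>K. real (p i) * (fact (sum (?q i) K + card P) * prod (block_weight (?q i)) P))
        = (\<Sum>I\<in>P. (real (sum p I) + 1) * ?c)"
      using sum_blocks[OF K(1) P] block by (simp flip: sum_blocks[OF K(1) P])
    also have "\<dots> = (\<Sum>I\<in>P. real (sum p I) + 1) * ?c"
      by (simp add: sum_distrib_right)
    also have "(\<Sum>I\<in>P. real (sum p I) + 1) = real (sum p K + card P)"
      using sum_blocks[OF K(1) P, of p] by (simp add: sum.distrib flip: of_nat_sum)
    finally show ?thesis unfolding m by (simp only: fact_Suc of_nat_fact mult.assoc of_nat_mult)
  qed
  then show ?thesis
    unfolding partition_sum_def sum_distrib_left
    by (subst sum.swap) simp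
qed

lemma partition_sum_cong:
  assumes "\<And>i. i \<in> K \<Longrightarrow> p i = q i"
  shows "partition_sum K p = partition_sum K q"
proof -
  have "block_weight p I = block_weight q I" if "partition_on K P" "I \<in> P" for P I
  proof -
    have "sum p I = sum q I"
      using that assms by (intro sum.cong) (auto simp: partition_on_def)
    then show ?thesis by (simp add: block_weight_def)
  qed
  moreover have "sum p K = sum q K" using assms by (rule sum.cong[OF refl])
  ultimately show ?thesis by (simp add: partition_sum_def)
qed

subsection \<open>Labelled fibres\<close>

definition fibre :: "nat \<Rightarrow> (nat \<Rightarrow> nat) \<Rightarrow> nat \<Rightarrow> nat set" where
  "fibre n \<phi> j = {i \<in> {1..n}. \<phi> i = j}"

lemma finite_fibre [simp]: "finite (fibre n \<phi> j)"
  by (simp add: fibre_def)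

lemma card_fibre_Suc:
  "card (fibre (Suc n) \<phi> j) = card (fibre n \<phi> j) + (if \<phi> (Suc n) = j then 1 else 0)"
proof -
  have "fibre (Suc n) \<phi> j = (if \<phi> (Suc n) = j then insert (Suc n) (fibre n \<phi> j) else fibre n \<phi> j)"
    by (auto simp: fibre_def le_Suc_eq)
  moreover have "Suc n \<notin> fibre n \<phi> j" by (simp add: fibre_def)
  ultimately show ?thesis by simp
qed

lemma fibre_upd_Suc [simp]: "fibre n (\<phi>(Suc n := x)) j = fibre n \<phi> j"
  by (auto simp: fibre_def)

text \<open>The bound \<open>\<phi> i \<le> n\<close> follows from \<open>\<phi> i \<le> i\<close>.
  The condition at each argument in this form does not mention \<open>n\<close>, which makes
  extension and restriction by one argument immediate.\<close>

lemma Leib_iff: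
  "\<phi> \<in> Leib n \<longleftrightarrow> (\<forall>i\<in>{1..n}. 1 \<le> \<phi> i \<and> \<phi> i \<le> i) \<and> (\<forall>i. i \<notin> {1..n} \<longrightarrow> \<phi> i = undefined)"
  unfolding Leib_def PiE_iff extensional_def by (auto intro: order_trans)

lemma finite_Leib: "finite (Leib n)"
  by (rule finite_subset[of _ "{1..n} \<rightarrow>\<^sub>E {1..n}"]) (auto simp: Leib_def intro!: finite_PiE)

lemma Leib_extend: "\<phi> \<in> Leib n \<Longrightarrow> j \<in> {1..Suc n} \<Longrightarrow> \<phi>(Suc n := j) \<in> Leib (Suc n)"
  by (auto simp: Leib_iff le_Suc_eq)

lemma Leib_restrict: "\<phi> \<in> Leib (Suc n) \<Longrightarrow> \<phi>(Suc n := undefined) \<in> Leib n"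
  by (auto simp: Leib_iff le_Suc_eq)

lemma Leib_undefined: "\<phi> \<in> Leib n \<Longrightarrow> \<phi> (Suc n) = undefined"
  by (simp add: Leib_iff)

text \<open>An argument in the fibre is at most \<open>n\<close>, and its value \<open>j\<close> is
  no larger. This keeps the labels below \<open>Suc n\<close> after the argument
  \<open>Suc n\<close> is deleted.\<close>

lemma fibre_nonempty_range:
  assumes "\<phi> \<in> Leib n" "card (fibre n \<phi> j) \<noteq> 0"
  shows "j \<in> {1..n}"
proof -
  obtain i where "i \<in> fibre n \<phi> j"
    using assms(2) by fastforce
  then show ?thesis
    using assms(1) by (auto simp: Leib_iff fibre_def intro: order_trans)
qed

section \<open>Labelled maps and the deletion of the largest argument\<close>

definition labelled_Leib ::
    "nat \<Rightarrow> 'a set \<Rightarrow> ('a \<Rightarrow> nat) \<Rightarrow> ((nat \<Rightarrow> nat) \<times> ('a \<Rightarrow> nat)) set" where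
  "labelled_Leib n K p = {(\<phi>, l). \<phi> \<in> Leib n \<and> l \<in> K \<rightarrow>\<^sub>E {1..n} \<and> inj_on l K \<and>
     (\<forall>a\<in>K. card (fibre n \<phi> (l a)) = p a)}"

lemma finite_labelled_Leib: "finite K \<Longrightarrow> finite (labelled_Leib n K p)"
  by (rule finite_subset[of _ "Leib n \<times> (K \<rightarrow>\<^sub>E {1..n})"])
    (auto simp: labelled_Leib_def finite_Leib intro!: finite_PiE)

text \<open>The labelled fibres are disjoint and their sizes add up to \<open>n\<close>, so they
  cover all arguments and leave none for another value.\<close>

lemma labelled_Leib_unlabelled_fibre:
  assumes "(\<phi>, l) \<in> labelled_Leib n K p" "finite K" "sum p K = n" "j \<notin> l ` K"
  shows "fibre n \<phi> j = {}"
proof -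
  have l: "inj_on l K" "\<And>a. a \<in> K \<Longrightarrow> card (fibre n \<phi> (l a)) = p a"
    using assms by (auto simp: labelled_Leib_def)
  have "card (\<Union>a\<in>K. fibre n \<phi> (l a)) = (\<Sum>a\<in>K. card (fibre n \<phi> (l a)))"
    using assms l by (intro card_UN_disjoint) (auto simp: fibre_def dest: inj_onD)
  then have "card (\<Union>a\<in>K. fibre n \<phi> (l a)) = card {1..n}"
    using l assms by simp
  then have cover: "(\<Union>a\<in>K. fibre n \<phi> (l a)) = {1..n}"
    by (intro card_subset_eq) (auto simp: fibre_def)
  show ?thesis
  proof (rule equals0I)
    fix i assume i: "i \<in> fibre n \<phi> j"
    then have "i \<in> (\<Union>a\<in>K. fibre n \<phi> (l a))" unfolding cover by (simp add: fibre_def)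
    then show False using i assms(4) by (auto simp: fibre_def)
  qed
qed

text \<open>A fibre with at least two elements survives the loss of \<open>Suc n\<close>, so
  \<open>l\<close> remains a labelling. Conversely \<open>Suc n\<close> can be put back in one way
  only, with value \<open>l a\<close>.\<close>

lemma labelled_Leib_last_shared:
  assumes "a \<in> K" "2 \<le> p a" and pos: "\<And>b. b \<in> K \<Longrightarrow> 1 \<le> p b"
  shows "card {(\<phi>, l) \<in> labelled_Leib (Suc n) K p. \<phi> (Suc n) = l a} =
    card (labelled_Leib n K (p(a := p a - 1)))"
    (is "card ?Y = card ?X")
proof -
  let ?q = "p(a := p a - 1)"
  have bij: "bij_betw (\<lambda>(\<phi>, l). (\<phi>(Suc n := l a), l)) ?X ?Y"
  proof (rule bij_betw_byWitness[of _ "\<lambda>(\<phi>, l). (\<phi>(Suc n := undefined), l)"])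
    show "\<forall>x\<in>?X. (\<lambda>(\<phi>, l). (\<phi>(Suc n := undefined), l)) ((\<lambda>(\<phi>, l). (\<phi>(Suc n := l a), l)) x) = x"
      by (auto simp: labelled_Leib_def Leib_undefined fun_eq_iff)
    show "\<forall>y\<in>?Y. (\<lambda>(\<phi>, l). (\<phi>(Suc n := l a), l)) ((\<lambda>(\<phi>, l). (\<phi>(Suc n := undefined), l)) y) = y"
      by (auto simp: fun_eq_iff)
    show "(\<lambda>(\<phi>, l). (\<phi>(Suc n := l a), l)) ` ?X \<subseteq> ?Y"
    proof clarsimp
      fix \<phi> l
      assume X: "(\<phi>, l) \<in> labelled_Leib n K (p(a := p a - Suc 0))"
      then have "l a \<in> {1..Suc n}" "\<And>b. b \<in> K \<Longrightarrow> l a = l b \<Longrightarrow> b = a"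
        using assms(1) by (force simp: labelled_Leib_def PiE_iff dest: inj_onD)+
      with X show "(\<phi>(Suc n := l a), l) \<in> labelled_Leib (Suc n) K p"
        using assms Leib_extend[of \<phi> n "l a"]
        by (auto simp: labelled_Leib_def card_fibre_Suc PiE_iff le_Suc_eq)
    qed
    show "(\<lambda>(\<phi>, l). (\<phi>(Suc n := undefined), l)) ` ?Y \<subseteq> ?X"
    proof clarsimp
      fix \<phi> l
      assume Y: "(\<phi>, l) \<in> labelled_Leib (Suc n) K p" and last: "\<phi> (Suc n) = l a"
      have card: "card (fibre n \<phi> (l b)) = ?q b" if "b \<in> K" for b
      proof -
        have "l a = l b \<longleftrightarrow> a = b"
          using Y that assms(1) by (auto simp: labelled_Leib_def dest: inj_onD)
        then show ?thesis
          using Y that last by (auto simp: labelled_Leib_def card_fibre_Suc)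
      qed
      have "l b \<in> {1..n}" if "b \<in> K" for b
      proof (rule fibre_nonempty_range[OF Leib_restrict[of \<phi>]])
        show "card (fibre n (\<phi>(Suc n := undefined)) (l b)) \<noteq> 0"
          using card[OF that] pos[OF that] assms(2) by auto
      qed (use Y in \<open>auto simp: labelled_Leib_def\<close>)
      then show "(\<phi>(Suc n := undefined), l) \<in> labelled_Leib n K (p(a := p a - Suc 0))"
        using Y card
        by (auto simp: labelled_Leib_def Leib_restrict PiE_iff)
    qed
  qed
  show ?thesis by (rule bij_betw_same_card[OF bij, symmetric])
qed

text \<open>Here \<open>Suc n\<close> is alone in its fibre, so the label \<open>a\<close>
  disappears with it. To go back, the value of \<open>Suc n\<close> may be anything in
  \<open>{1..Suc n}\<close> that the other labels do not use; injectivity of \<open>l\<close> makes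
  the number of choices constant.\<close>

lemma labelled_Leib_last_new:
  assumes "finite K" "a \<in> K" "p a = 1" "sum p K = Suc n" "\<And>b. b \<in> K \<Longrightarrow> 1 \<le> p b"
  shows "card {(\<phi>, l) \<in> labelled_Leib (Suc n) K p. \<phi> (Suc n) = l a} =
    (Suc n - card (K - {a})) * card (labelled_Leib n (K - {a}) p)"
    (is "card ?Y = _")
proof -
  let ?X = "labelled_Leib n (K - {a}) p"
  let ?Z = "SIGMA x:?X. {1..Suc n} - snd x ` (K - {a})"
  have sum: "sum p (K - {a}) = n"
    using assms by (simp add: sum.remove)
  have bij: "bij_betw (\<lambda>((\<phi>, l), j). (\<phi>(Suc n := j), l(a := j))) ?Z ?Y"
  \<comment> \<open>The inverse records the deleted value \<open>l a\<close> and resets both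
    functions to \<open>undefined\<close> there, because they are extensional on the smaller
    domains.\<close>
  proof (rule bij_betw_byWitness[of _ "\<lambda>(\<phi>, l). ((\<phi>(Suc n := undefined), l(a := undefined)), l a)"])
    show "\<forall>z\<in>?Z. (\<lambda>(\<phi>, l). ((\<phi>(Suc n := undefined), l(a := undefined)), l a))
        ((\<lambda>((\<phi>, l), j). (\<phi>(Suc n := j), l(a := j))) z) = z"
      by (auto simp: labelled_Leib_def Leib_undefined fun_eq_iff PiE_iff extensional_def)
    show "\<forall>y\<in>?Y. (\<lambda>((\<phi>, l), j). (\<phi>(Suc n := j), l(a := j)))
        ((\<lambda>(\<phi>, l). ((\<phi>(Suc n := undefined), l(a := undefined)), l a)) y) = y"
      by (auto simp: fun_eq_iff)
    show "(\<lambda>((\<phi>, l), j). (\<phi>(Suc n := j), l(a := j))) ` ?Z \<subseteq> ?Y"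
    proof clarsimp
      fix \<phi> l j
      assume X: "(\<phi>, l) \<in> ?X" and j: "Suc 0 \<le> j" "j \<le> Suc n" "j \<notin> l ` (K - {a})"
      \<comment> \<open>The remaining labelled fibres exhaust \<open>{1..n}\<close>; hence the new
        fibre over \<open>j\<close> is exactly \<open>{Suc n}\<close>, of size
        \<open>p a = 1\<close>.\<close>
      have "fibre n \<phi> j = {}"
        using labelled_Leib_unlabelled_fibre[OF X _ sum j(3)] assms by simp
      moreover have "\<And>b. b \<in> K \<Longrightarrow> b \<noteq> a \<Longrightarrow> l b \<noteq> j" using j by blast
      ultimately show "(\<phi>(Suc n := j), l(a := j)) \<in> labelled_Leib (Suc n) K p"
        using X j assms(2,3)
        by (auto simp: labelled_Leib_def Leib_extend card_fibre_Suc PiE_iff le_Suc_eq inj_on_def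
            extensional_def)
    qed
    show "(\<lambda>(\<phi>, l). ((\<phi>(Suc n := undefined), l(a := undefined)), l a)) ` ?Y \<subseteq> ?Z"
    proof (rule image_subsetI)
      fix y assume "y \<in> ?Y"
      then obtain \<phi> l where y: "y = (\<phi>, l)"
        and Y: "(\<phi>, l) \<in> labelled_Leib (Suc n) K p" and last: "\<phi> (Suc n) = l a" by blast
      have ne: "l b \<noteq> l a" if "b \<in> K - {a}" for b
        using that Y assms(2) by (auto simp: labelled_Leib_def dest: inj_onD)
      have card: "card (fibre n \<phi> (l b)) = p b" if "b \<in> K - {a}" for b
        using Y that last ne[OF that] by (auto simp: labelled_Leib_def card_fibre_Suc)
      have "l b \<in> {1..n}" if "b \<in> K - {a}" for b
      proof (rule fibre_nonempty_range[OF Leib_restrict[of \<phi>]])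
        show "card (fibre n (\<phi>(Suc n := undefined)) (l b)) \<noteq> 0"
          using card[OF that] assms(5)[of b] that by auto
      qed (use Y in \<open>auto simp: labelled_Leib_def\<close>)
      then have "l(a := undefined) \<in> K - {a} \<rightarrow>\<^sub>E {1..n}"
        using Y by (auto simp: labelled_Leib_def PiE_iff extensional_def)
      moreover have "inj_on (l(a := undefined)) (K - {a})"
        using Y by (auto simp: labelled_Leib_def inj_on_def)
      ultimately have "(\<phi>(Suc n := undefined), l(a := undefined)) \<in> ?X"
        using Y card by (simp add: labelled_Leib_def Leib_restrict)
      moreover have "l a \<in> {1..Suc n}"
        using Y assms(2) by (auto simp: labelled_Leib_def PiE_iff)
      moreover have "l a \<notin> l(a := undefined) ` (K - {a})"
        using ne by (metis fun_upd_other imageE)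
      ultimately show "(case y of (\<phi>, l) \<Rightarrow> ((\<phi>(Suc n := undefined), l(a := undefined)), l a)) \<in> ?Z"
        unfolding y by simp
    qed
  qed
  have count: "card ({1..Suc n} - snd x ` (K - {a})) = Suc n - card (K - {a})" if "x \<in> ?X" for x
  proof -
    have "snd x ` (K - {a}) \<subseteq> {1..Suc n}" "inj_on (snd x) (K - {a})"
      using that by (force simp: labelled_Leib_def PiE_iff)+
    then show ?thesis
      using assms(1) by (simp add: card_Diff_subset card_image)
  qed
  have "card ?Y = card ?Z" using bij_betw_same_card[OF bij] by simp
  also have "\<dots> = (\<Sum>x\<in>?X. Suc n - card (K - {a}))"
    using assms(1) finite_labelled_Leib[of "K - {a}"] count by (simp add: card_SigmaI)
  finally show ?thesis by simp
qed

text \<open>The fibre through \<open>Suc n\<close> is nonempty and so carries a label, which is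
  unique because \<open>l\<close> is injective.\<close>

lemma card_labelled_Leib_Suc:
  assumes "finite K" "sum p K = Suc n"
  shows "card (labelled_Leib (Suc n) K p) =
    (\<Sum>a\<in>K. card {(\<phi>, l) \<in> labelled_Leib (Suc n) K p. \<phi> (Suc n) = l a})"
proof -
  let ?X = "labelled_Leib (Suc n) K p"
  have "\<phi> (Suc n) \<in> l ` K" if "(\<phi>, l) \<in> ?X" for \<phi> l
  proof (rule ccontr)
    assume "\<phi> (Suc n) \<notin> l ` K"
    then have "fibre (Suc n) \<phi> (\<phi> (Suc n)) = {}"
      by (rule labelled_Leib_unlabelled_fibre[OF that assms])
    then show False by (auto simp: fibre_def)
  qed
  then have "?X = (\<Union>a\<in>K. {(\<phi>, l) \<in> ?X. \<phi> (Suc n) = l a})" by fastforce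
  then have "card ?X = card (\<Union>a\<in>K. {(\<phi>, l) \<in> ?X. \<phi> (Suc n) = l a})" by simp
  also have "\<dots> = (\<Sum>a\<in>K. card {(\<phi>, l) \<in> ?X. \<phi> (Suc n) = l a})"
  proof (intro card_UN_disjoint ballI impI assms(1))
    show "finite {(\<phi>, l) \<in> ?X. \<phi> (Suc n) = l a}" for a
      by (rule finite_subset[OF _ finite_labelled_Leib[OF assms(1)]]) auto
    show "{(\<phi>, l) \<in> ?X. \<phi> (Suc n) = l a} \<inter> {(\<phi>, l) \<in> ?X. \<phi> (Suc n) = l b} = {}"
      if "a \<in> K" "b \<in> K" "a \<noteq> b" for a b
      using that by (auto simp: labelled_Leib_def dest: inj_onD)
  qed
  finally show ?thesis .
qed

text \<open>The two recursions agree term by term. If \<open>p a = 1\<close>, the lowered entry is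
  0, and the minus sign from deleting the label is absorbed by the change of \<open>card K\<close>.
  If \<open>p a \<ge> 2\<close>, the factor \<open>p a\<close> cancels against the factorial of
  \<open>p a\<close>. Both \<open>K\<close> and \<open>p\<close> vary in the induction.\<close>

lemma card_labelled_Leib:
  assumes "finite K" "\<And>a. a \<in> K \<Longrightarrow> 1 \<le> p a" "sum p K = n"
  shows "real (card (labelled_Leib n K p)) =
    (-1) ^ card K / (\<Prod>i\<in>K. fact (p i)) * partition_sum K p"
  using assms
proof (induction n arbitrary: K p)
  case 0
  then have "K = {}" by force
  \<comment> \<open>There is one empty map with one empty labelling; on the other side the empty set
    partition contributes 0! = 1.\<close>
  moreover have "labelled_Leib 0 {} p = {(\<lambda>_. undefined, \<lambda>_. undefined)}"
    by (auto simp: labelled_Leib_def Leib_def)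
  ultimately show ?case
    by (simp add: partition_sum_def partition_on_empty)
next
  case (Suc n)
  let ?c = "(-1) ^ card K / (\<Prod>i\<in>K. fact (p i)) :: real"
  have "real (card {(\<phi>, l) \<in> labelled_Leib (Suc n) K p. \<phi> (Suc n) = l a}) =
      ?c * (real (p a) * partition_sum K (p(a := p a - 1)))" if a: "a \<in> K" for a
  proof (cases "p a = 1")
    case True
    let ?K = "K - {a}" and ?q = "p(a := 0)"
    have K: "insert a ?K = K" "finite ?K" "card K = Suc (card ?K)"
      using a Suc.prems(1) card_Suc_Diff1[OF Suc.prems(1) a] by auto
    have sum: "sum p ?K = n"
      using Suc.prems a True by (simp add: sum.remove)
    \<comment> \<open>Every remaining label has a positive entry, so there are at most
      \<open>n\<close> of them and the truncated subtraction \<open>Suc n - card ?K\<close> is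
      exact.\<close>
    have "card ?K \<le> n"
      using sum_mono[of ?K "\<lambda>_. 1" p] Suc.prems(2) sum by simp
    then have factor: "real (Suc n - card ?K) = real n + 1 - real (card ?K)"
      by (simp add: of_nat_diff)
    have "sum ?q ?K = n" using sum by simp
    moreover have "partition_sum ?K ?q = partition_sum ?K p" by (rule partition_sum_cong) simp
    ultimately have "partition_sum K ?q = - (real n + 1 - real (card ?K)) * partition_sum ?K p"
      using partition_sum_insert_zero[of ?K a ?q] K by simp
    moreover have "real (card (labelled_Leib n ?K p)) =
        (-1) ^ card ?K / (\<Prod>i\<in>?K. fact (p i)) * partition_sum ?K p"
      using K(2) Suc.prems(2) sum by (intro Suc.IH) auto
    moreover have "(\<Prod>i\<in>K. fact (p i)) = (\<Prod>i\<in>?K. fact (p i) :: real)"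
      using Suc.prems(1) a True by (simp add: prod.remove)
    moreover have "card {(\<phi>, l) \<in> labelled_Leib (Suc n) K p. \<phi> (Suc n) = l a} =
        (Suc n - card ?K) * card (labelled_Leib n ?K p)"
      using Suc.prems a True by (intro labelled_Leib_last_new) auto
    ultimately show ?thesis
      unfolding K(3) True One_nat_def diff_self_eq_0 
      by (simp only: of_nat_mult factor) (simp add: algebra_simps add_divide_distrib diff_divide_distrib)
  next
    case False
    let ?q = "p(a := p a - 1)"
    have pa: "2 \<le> p a" using False Suc.prems(2)[OF a] by simp
    have "sum ?q K = n"
      using Suc.prems a pa by (simp add: sum.remove)
    then have "real (card (labelled_Leib n K ?q)) =
        (-1) ^ card K / (\<Prod>i\<in>K. fact (?q i)) * partition_sum K ?q"
      using Suc.prems pa by (intro Suc.IH) auto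
    moreover have "(\<Prod>i\<in>K. fact (p i)) = real (p a) * (\<Prod>i\<in>K. fact (?q i))"
    proof -
      have "(\<Prod>i\<in>K. fact (?q i)) = fact (p a - 1) * (\<Prod>i\<in>K - {a}. fact (p i) :: real)"
        using Suc.prems(1) a by (simp add: prod.remove)
      moreover have "fact (p a) = real (p a) * fact (p a - 1)"
        using pa by (simp add: fact_reduce)
      ultimately show ?thesis
        using prod.remove[OF Suc.prems(1) a, of "\<lambda>i. fact (p i) :: real"] by simp
    qed
    ultimately show ?thesis
      using labelled_Leib_last_shared[OF a, of p n] pa Suc.prems(2) by simp
  qed
  moreover have "K \<noteq> {}" using Suc.prems by auto
  ultimately show ?case
    using Suc.prems
    by (simp add: card_labelled_Leib_Suc partition_sum_decrement[of K p] sum_distrib_left)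
qed

subsection \<open>Removing the labels\<close>

text \<open>Only the multiplicity of \<open>x\<close> changes, from m to m + 1, and (m + 1)! = (m +
  1) m!.\<close>

lemma prod_fact_count_add_mset:
  "(\<Prod>v\<in>set_mset (add_mset x A). fact (count (add_mset x A) v)) =
    Suc (count A x) * (\<Prod>v\<in>set_mset A. fact (count A v))"
proof -
  \<comment> \<open>If \<open>x\<close> does not occur in \<open>A\<close>, including it as an index
    adds the factor 0! = 1, so both cases can be treated together.\<close>
  have "(\<Prod>v\<in>set_mset A. fact (count A v)) = (\<Prod>v\<in>insert x (set_mset A). fact (count A v) :: nat)"
    by (rule prod.mono_neutral_left) (auto simp: not_in_iff)
  also have "\<dots> = fact (count A x) * (\<Prod>v\<in>set_mset A - {x}. fact (count A v))"
    by (simp add: prod.insert_remove)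
  finally have "(\<Prod>v\<in>set_mset A. fact (count A v)) =
      fact (count A x) * (\<Prod>v\<in>set_mset A - {x}. fact (count A v) :: nat)" .
  moreover have "(\<Prod>v\<in>set_mset A - {x}. fact (count (add_mset x A) v)) =
      (\<Prod>v\<in>set_mset A - {x}. fact (count A v) :: nat)"
    by (intro prod.cong) auto
  ultimately show ?thesis
    by (simp add: prod.insert_remove algebra_simps del: count_add_mset) (simp add: algebra_simps)
qed

text \<open>The image of \<open>a\<close> can be any \<open>s\<close> with \<open>c s = p a\<close>,
  and the number of these is the multiplicity of \<open>p a\<close>. Removing \<open>a\<close> and
  \<open>s\<close> removes the same value from both multisets, so the hypothesis persists with
  \<open>S - {s}\<close> and induction yields the product of factorials.\<close>

lemma card_fibre_preserving_injections:
  assumes "finite K" "finite S" "image_mset c (mset_set S) = image_mset p (mset_set K)"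
  shows "card {l \<in> K \<rightarrow>\<^sub>E S. inj_on l K \<and> (\<forall>a\<in>K. c (l a) = p a)} =
    (\<Prod>v\<in>set_mset (image_mset p (mset_set K)). fact (count (image_mset p (mset_set K)) v))"
  using assms
proof (induction K arbitrary: S rule: finite_induct)
  case empty
  then show ?case by (simp add: PiE_empty_domain)
next
  case (insert a K)
  let ?A = "image_mset p (mset_set K)"
  let ?L = "\<lambda>K S. {l \<in> K \<rightarrow>\<^sub>E S. inj_on l K \<and> (\<forall>a\<in>K. c (l a) = p a)}"
  let ?T = "{s \<in> S. c s = p a}"
  have A: "image_mset c (mset_set S) = add_mset (p a) ?A"
    using insert by simp
  have rest: "image_mset c (mset_set (S - {s})) = ?A" if "s \<in> ?T" for s
  proof -
    have "mset_set S = add_mset s (mset_set (S - {s}))"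
      using that insert.prems(1) by (simp add: mset_set.remove)
    then show ?thesis using A that by simp
  qed
  have "count (image_mset c (mset_set S)) (p a) = card ?T"
    using insert.prems(1)
    by (simp add: count_image_mset Int_def vimage_def conj_commute)
  then have T: "card ?T = Suc (count ?A (p a))" using A by simp
  have "bij_betw (\<lambda>(s, l). l(a := s)) (SIGMA s:?T. ?L K (S - {s})) (?L (insert a K) S)"
  proof (rule bij_betw_byWitness[of _ "\<lambda>l. (l a, l(a := undefined))"])
    show "\<forall>z\<in>(SIGMA s:?T. ?L K (S - {s})). (\<lambda>l. (l a, l(a := undefined))) ((\<lambda>(s, l). l(a := s)) z) = z"
      using insert.hyps by (auto simp: fun_eq_iff PiE_iff extensional_def)
    show "\<forall>l\<in>?L (insert a K) S. (\<lambda>(s, l). l(a := s)) ((\<lambda>l. (l a, l(a := undefined))) l) = l"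
      by auto
    show "(\<lambda>(s, l). l(a := s)) ` (SIGMA s:?T. ?L K (S - {s})) \<subseteq> ?L (insert a K) S"
    proof (rule image_subsetI)
      fix z
      assume "z \<in> (SIGMA s:?T. ?L K (S - {s}))"
      then obtain s l where "z = (s, l)" "s \<in> S" "c s = p a" "l \<in> ?L K (S - {s})" by blast
      then show "(case z of (s, l) \<Rightarrow> l(a := s)) \<in> ?L (insert a K) S"
        using insert.hyps by (auto simp: PiE_iff extensional_def inj_on_def)
    qed
    show "(\<lambda>l. (l a, l(a := undefined))) ` ?L (insert a K) S \<subseteq> (SIGMA s:?T. ?L K (S - {s}))"
    proof (rule image_subsetI)
      fix l assume "l \<in> ?L (insert a K) S"
      then have l: "l \<in> insert a K \<rightarrow>\<^sub>E S" "inj_on l (insert a K)" "\<And>b. b \<in> insert a K \<Longrightarrow> c (l b) = p b"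
        by blast+
      have K: "(l(a := undefined)) b = l b" if "b \<in> K" for b
        using that insert.hyps by auto
      have "l b \<noteq> l a" if "b \<in> K" for b
        using inj_onD[OF l(2), of b a] that insert.hyps by auto
      then have "l(a := undefined) \<in> K \<rightarrow>\<^sub>E S - {l a}"
        using l(1) insert.hyps by (auto simp: PiE_iff extensional_def)
      moreover have "inj_on (l(a := undefined)) K"
        using l(2) K by (simp cong: inj_on_cong)
      ultimately show "(l a, l(a := undefined)) \<in> (SIGMA s:?T. ?L K (S - {s}))"
        using l K by (auto simp: PiE_iff)
    qed
  qed
  then have "card (?L (insert a K) S) = card (SIGMA s:?T. ?L K (S - {s}))"
    by (simp add: bij_betw_same_card)
  also have "\<dots> = (\<Sum>s\<in>?T. card (?L K (S - {s})))"
  proof (intro card_SigmaI ballI)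
    show "finite ?T" using insert.prems(1) by simp
    show "finite (?L K (S - {s}))" for s
      by (rule finite_subset[of _ "K \<rightarrow>\<^sub>E S - {s}"])
        (use insert.hyps insert.prems(1) in \<open>auto intro!: finite_PiE\<close>)
  qed
  also have "\<dots> = (\<Sum>s\<in>?T. \<Prod>v\<in>set_mset ?A. fact (count ?A v))"
    using insert.prems(1) rest by (intro sum.cong refl insert.IH) auto
  also have "\<dots> = Suc (count ?A (p a)) * (\<Prod>v\<in>set_mset ?A. fact (count ?A v))"
    using T by simp
  finally show ?case
    unfolding prod_fact_count_add_mset[symmetric] using insert.hyps by simp
qed

section \<open>Integer partitions as multisets of fibre sizes\<close>

lemma mset_Theta:
  "mset (Theta n \<phi>) =
    image_mset (\<lambda>j. card (fibre n \<phi> j)) (mset_set {j \<in> {1..n}. card (fibre n \<phi> j) \<noteq> 0})"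
proof -
  have "mset (Theta n \<phi>) =
      filter_mset (\<lambda>x. x \<noteq> 0) (image_mset (\<lambda>j. card (fibre n \<phi> j)) (mset_set {1..<Suc n}))"
    by (simp only: Theta_def fibre_def mset_rev mset_sort mset_filter mset_map mset_upt)
  then show ?thesis
    by (simp only: filter_mset_image_mset filter_mset_mset_set finite_atLeastLessThan finite_atLeastAtMost
        atLeastLessThanSuc_atLeastAtMost)
qed

text \<open>Both lists are weakly decreasing, so their multisets determine them; they are reversed
  to apply uniqueness of sorting.\<close>

lemma Theta_eq_iff:
  assumes "is_partition p"
  shows "Theta n \<phi> = p \<longleftrightarrow> mset (Theta n \<phi>) = mset p"
proof
  assume "mset (Theta n \<phi>) = mset p"
  then have "mset (rev (Theta n \<phi>)) = mset (rev p)" by simp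
  moreover have "sorted (rev (Theta n \<phi>))" by (simp add: Theta_def)
  moreover have "sorted (rev p)"
    using assms by (simp add: is_partition_def sorted_wrt_rev)
  ultimately have "rev (Theta n \<phi>) = rev p"
    by (metis properties_for_sort)
  then show "Theta n \<phi> = p" by simp
qed simp

lemma mset_part: "mset p = image_mset (part p) (mset_set {1..length p})"
proof -
  have "p = map (part p) [1..<Suc (length p)]"
    by (rule nth_equalityI) (auto simp: Defs.part_def simp del: upt_Suc)
  then have "mset p = mset (map (part p) [1..<Suc (length p)])" by simp
  then show ?thesis by (simp add: atLeastLessThanSuc_atLeastAtMost del: upt_Suc)
qed

lemma sum_part: "sum (part p) {1..length p} = sum_list p"
proof -
  have "sum_list p = sum_mset (mset p)" by (simp add: sum_mset_sum_list)
  also have "\<dots> = sum (part p) {1..length p}" by (subst mset_part) (simp add: sum_unfold_sum_mset)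
  finally show ?thesis by simp
qed

lemma part_ge_1: "is_partition p \<Longrightarrow> a \<in> {1..length p} \<Longrightarrow> 1 \<le> part p a"
  by (auto simp: is_partition_def Defs.part_def)

text \<open>For a fixed \<open>\<phi>\<close>, a labelling matches the labels with the nonempty
  fibres by size. If \<open>\<phi>\<close> has type \<open>p\<close>, equal parts may be permuted,
  which gives the symmetry factor; otherwise no labelling exists.\<close>

lemma card_labelled_Leib_eq_N_p:
  assumes "is_partition p"
  shows "card (labelled_Leib (sum_list p) {1..length p} (part p)) = symmetry_factor p * N_p p"
proof -
  let ?n = "sum_list p" and ?K = "{1..length p}"
  let ?L = "\<lambda>\<phi>. {l \<in> ?K \<rightarrow>\<^sub>E {1..?n}. inj_on l ?K \<and> (\<forall>a\<in>?K. card (fibre ?n \<phi> (l a)) = part p a)}"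
  have L: "card (?L \<phi>) = (if Theta ?n \<phi> = p then symmetry_factor p else 0)"
    if \<phi>: "\<phi> \<in> Leib ?n" for \<phi>
  proof -
    define c where "c = (\<lambda>j. card (fibre ?n \<phi> j))"
    let ?S = "{j \<in> {1..?n}. c j \<noteq> 0}"
    \<comment> \<open>All parts are positive, so \<open>l\<close> can only hit values with nonempty
      fibre.\<close>
    have L_S: "?L \<phi> = {l \<in> ?K \<rightarrow>\<^sub>E ?S. inj_on l ?K \<and> (\<forall>a\<in>?K. c (l a) = part p a)}"
      using part_ge_1[OF assms] by (fastforce simp: c_def PiE_iff)
    show ?thesis
    proof (cases "Theta ?n \<phi> = p")
      case True
      then have "image_mset c (mset_set ?S) = image_mset (part p) (mset_set ?K)"
        using mset_Theta[of ?n \<phi>] mset_part[of p] by (simp add: c_def)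
      then have "card (?L \<phi>) = (\<Prod>v\<in>set_mset (mset p). fact (count (mset p) v))"
        unfolding L_S mset_part by (intro card_fibre_preserving_injections) auto
      then show ?thesis using True by (simp add: symmetry_factor_def count_mset)
    next
      case False
      have "?L \<phi> = {}"
      proof (rule ccontr)
        assume "?L \<phi> \<noteq> {}"
        then obtain l where l: "l \<in> ?L \<phi>" by blast
        then have X: "(\<phi>, l) \<in> labelled_Leib ?n ?K (part p)"
          using \<phi> by (simp add: labelled_Leib_def)
        \<comment> \<open>A labelling reaches every nonempty fibre, so it would exhibit the parts of
          \<open>p\<close> as the fibre sizes of \<open>\<phi>\<close>.\<close>
        have "l ` ?K = ?S"
        proof
          show "l ` ?K \<subseteq> ?S" using l unfolding L_S by auto
          show "?S \<subseteq> l ` ?K"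
            using labelled_Leib_unlabelled_fibre[OF X _ sum_part] by (force simp: c_def)
        qed
        then have "mset (Theta ?n \<phi>) = image_mset c (image_mset l (mset_set ?K))"
          using l by (simp add: mset_Theta c_def image_mset_mset_set)
        also have "\<dots> = image_mset (part p) (mset_set ?K)"
          using l unfolding L_S multiset.map_comp by (intro image_mset_cong) auto
        finally show False
          using False Theta_eq_iff[OF assms] mset_part by metis
      qed
      then show ?thesis using False by (simp only: card.empty if_False)
    qed
  qed
  have "labelled_Leib ?n ?K (part p) = (SIGMA \<phi>:Leib ?n. ?L \<phi>)"
    by (auto simp: labelled_Leib_def)
  then have "card (labelled_Leib ?n ?K (part p)) = (\<Sum>\<phi>\<in>Leib ?n. card (?L \<phi>))"
    by (simp add: card_SigmaI finite_Leib finite_PiE)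
  also have "\<dots> = (\<Sum>\<phi>\<in>Leib ?n. if Theta ?n \<phi> = p then symmetry_factor p else 0)"
    using L by (intro sum.cong) auto
  also have "\<dots> = symmetry_factor p * N_p p"
    by (simp add: N_p_def finite_Leib flip: sum.inter_filter)
  finally show ?thesis .
qed

subsection \<open>Set partitions as ordered lists of blocks\<close>

text \<open>Disjoint nonempty blocks have distinct minima, so each set partition has exactly one
  arrangement by increasing minimum.\<close>

lemma bij_betw_ordered_set_partitions:
  "bij_betw set (ordered_set_partitions k) {P. partition_on {1..k} P}"
proof -
  have inj_Min: "inj_on Min P" if P: "partition_on {1..k} P" for P
  proof (rule inj_onI)
    fix I J assume *: "I \<in> P" "J \<in> P" "Min I = Min J"
    have "Min B \<in> B" if "B \<in> P" for B
    proof (rule Min_in)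
      show "finite B" using P that finite_subset[of B "{1..k}"] by (auto simp: partition_on_def)
      show "B \<noteq> {}" using P that by (auto simp: partition_on_def)
    qed
    then have "Min I \<in> I" "Min I \<in> J" using * by metis+
    then show "I = J" using * disjointD[OF partition_onD2[OF P], of I J] by auto
  qed
  show ?thesis
  proof (rule bij_betwI')
    fix Is Js assume osp: "Is \<in> ordered_set_partitions k" "Js \<in> ordered_set_partitions k"
    have "Is = Js" if eq: "set Is = set Js"
    proof -
      have "sorted_wrt (<) (map Min Is)" "sorted_wrt (<) (map Min Js)"
        using osp by (auto simp: ordered_set_partitions_def sorted_wrt_map)
      then have "map Min Is = map Min Js"
        using eq by (intro strict_sorted_equal) auto
      moreover have "inj_on Min (set Is \<union> set Js)"
        using osp eq inj_Min by (simp add: ordered_set_partitions_def)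
      ultimately show ?thesis using map_inj_on by blast
    qed
    then show "(set Is = set Js) = (Is = Js)" by blast
  next
    fix Is assume "Is \<in> ordered_set_partitions k"
    then show "set Is \<in> {P. partition_on {1..k} P}" by (simp add: ordered_set_partitions_def)
  next
    fix P assume "P \<in> {P. partition_on {1..k} P}"
    then have P: "partition_on {1..k} P" by simp
    then have finP: "finite P" using finite_elements by blast
    \<comment> \<open>Sort the minima, then send each minimum back to its block.\<close>
    define Is where "Is = map (the_inv_into P Min) (sorted_list_of_set (Min ` P))"
    have "map Min Is = sorted_list_of_set (Min ` P)"
      unfolding Is_def map_map
      by (rule map_idI) (use finP in \<open>auto simp: f_the_inv_into_f[OF inj_Min[OF P]]\<close>)
    then have "sorted_wrt (\<lambda>I J. Min I < Min J) Is"
      using strict_sorted_list_of_set[of "Min ` P"] sorted_wrt_map[of "(<)" Min Is] by simp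
    moreover have "set Is = P"
      using finP the_inv_into_onto[OF inj_Min[OF P]] by (simp add: Is_def)
    ultimately show "\<exists>Is\<in>ordered_set_partitions k. P = set Is"
      using P by (auto simp: ordered_set_partitions_def)
  qed
qed

text \<open>For each block, p_I! from the inner multinomial coefficient over (p_I + 1)! from the
  outer one leaves 1 / (p_I + 1). The sign (-1)^h gives one minus per block, and the factorials of
  the parts collect into the common factor.\<close>

lemma summand_eq_block_weights:
  fixes p :: "nat list"
  defines "k \<equiv> length p"
  assumes "Is \<in> ordered_set_partitions k"
  shows "(-1) ^ (k + length Is) * (\<Prod>j<length Is. fact (card (Is ! j))) *
       (\<Prod>j<length Is. multinomial (psum p (Is ! j)) (Is ! j) (part p)) *
       multinomial (sum_list p + length Is) {..<length Is} (\<lambda>j. psum p (Is ! j) + 1) =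
    (-1) ^ k / (\<Prod>i\<in>{1..k}. fact (part p i)) *
      (fact (sum (part p) {1..k} + card (set Is)) * (\<Prod>I\<in>set Is. block_weight (part p) I))"
proof -
  let ?P = "set Is" and ?h = "length Is"
  let ?D = "\<lambda>I. \<Prod>i\<in>I. fact (part p i) :: real"
  have P: "partition_on {1..k} ?P" and sorted: "sorted_wrt (\<lambda>I J. Min I < Min J) Is"
    using assms by (auto simp: ordered_set_partitions_def)
  have "distinct (map Min Is)"
    using sorted sorted_wrt_map[of "(<)" Min Is] strict_sorted_iff by metis
  then have dist: "distinct Is" by (simp add: distinct_map)
  have nth: "(\<Prod>j<?h. f (Is ! j)) = prod f ?P" for f :: "nat set \<Rightarrow> real"
    by (rule prod.reindex_bij_betw[OF bij_betw_nth[OF dist]]) auto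
  have card: "card ?P = ?h" using dist by (rule distinct_card)
  have prod_D: "(\<Prod>i\<in>{1..k}. fact (part p i)) = prod ?D ?P"
    using prod.partition[OF _ P, of "\<lambda>i. fact (part p i) :: real"] by simp
  have "- 1 * fact (card I) * multinomial (psum p I) I (part p) / fact (psum p I + 1) =
      block_weight (part p) I / ?D I" for I
  proof -
    have "psum p I = sum (part p) I" by (simp add: psum_def)
    moreover have "- 1 * c * (F / D) / ((s + 1) * F) = - c / (s + 1) / D"
      if "F \<noteq> 0" for c F D s :: real
      using that by simp
    moreover have "fact (psum p I + 1) = (real (psum p I) + 1) * fact (psum p I)"
      by (simp add: algebra_simps)
    ultimately show ?thesis
      unfolding multinomial_def block_weight_def by (metis fact_nonzero)
  qed
  then have "prod (block_weight (part p)) ?P / prod ?D ?P =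
      (\<Prod>I\<in>?P. - 1 * fact (card I) * multinomial (psum p I) I (part p) / fact (psum p I + 1))"
    by (simp only: prod_dividef)
  also have "\<dots> = (-1) ^ ?h * (\<Prod>I\<in>?P. fact (card I)) *
      (\<Prod>I\<in>?P. multinomial (psum p I) I (part p)) / (\<Prod>I\<in>?P. fact (psum p I + 1))"
    by (simp only: prod_dividef prod.distrib prod_constant card)
  finally have "prod (block_weight (part p)) ?P / prod ?D ?P =
      (-1) ^ ?h * (\<Prod>I\<in>?P. fact (card I)) *
      (\<Prod>I\<in>?P. multinomial (psum p I) I (part p)) / (\<Prod>I\<in>?P. fact (psum p I + 1))" .
  \<comment> \<open>Here \<open>e\<close> and \<open>s\<close> are the signs (-1)^k and (-1)^h,
    \<open>A\<close> and \<open>B\<close> the products of block factorials and of inner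
    multinomials, \<open>F / C\<close> the outer multinomial, \<open>W\<close> the product of block
    weights and \<open>D\<close> that of the part factorials.\<close>
  moreover have "e * s * A * B * (F / C) = e / D * (F * W)" if "W / D = s * A * B / C"
    for W D s A B C e F :: real
  proof -
    have "e / D * (F * W) = e * F * (W / D)" by simp
    then show ?thesis using that by simp
  qed
  ultimately show ?thesis
    unfolding multinomial_def[of "sum_list p + ?h"] prod_D[unfolded k_def] card k_def sum_part power_add
      nth[of "\<lambda>I. fact (card I)"] nth[of "\<lambda>I. multinomial (psum p I) I (part p)"]
      nth[of "\<lambda>I. fact (psum p I + 1)"]
    by blast
qed

theorem theorem7p4:
  fixes p :: "nat list" and k :: nat
  assumes "is_partition p" and "length p = k" and "k \<ge> 1"
  shows "real (N_p p) = 1 / real (symmetry_factor p) *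
    (\<Sum>Is\<in>ordered_set_partitions k. let h = length Is in
       (-1) ^ (k + h) * (\<Prod>j<h. fact (card (Is ! j))) *
       (\<Prod>j<h. multinomial (psum p (Is ! j)) (Is ! j) (part p)) *
       multinomial (sum_list p + h) {..<h} (\<lambda>j. psum p (Is ! j) + 1))"
    (is "_ = _ * ?R")
proof -
  let ?c = "(-1) ^ k / (\<Prod>i\<in>{1..k}. fact (part p i)) :: real"
  let ?t = "\<lambda>P. fact (sum (part p) {1..k} + card P) * (\<Prod>I\<in>P. block_weight (part p) I)"
  have "?R = (\<Sum>Is\<in>ordered_set_partitions k. ?c * ?t (set Is))"
    unfolding Let_def using assms(2) summand_eq_block_weights[of _ p] by (intro sum.cong) auto
  also have "\<dots> = ?c * partition_sum {1..k} (part p)"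
    unfolding partition_sum_def sum_distrib_left
    by (rule sum.reindex_bij_betw[OF bij_betw_ordered_set_partitions])
  also have "\<dots> = real (card (labelled_Leib (sum_list p) {1..k} (part p)))"
    using card_labelled_Leib[of "{1..k}" "part p"] part_ge_1[OF assms(1)] sum_part[of p] assms(2)
    by simp
  also have "\<dots> = real (symmetry_factor p) * real (N_p p)"
    using card_labelled_Leib_eq_N_p[OF assms(1)] assms(2) by simp
  \<comment> \<open>A product of factorials is nonzero, so the symmetry factor can be divided
    out.\<close>
  finally show ?thesis
    by (simp add: symmetry_factor_def)
qed

end
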